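(* Let $\{\alpha_i\}_{i=0}^\infty$ be a sequence of real numbers that is trivial, i.e. $\alpha_i\neq 0$ for at most two indices $i$. Then $\{\alpha_i\}_{i=0}^\infty$ is a discrete multiplier sequence if and only if there is an integer $m\ge 0$ such that $\alpha_m\alpha_{m+1}\ge 0$ and $\alpha_i=0$ unless $i\in\{m,m+1\}$.
   Context: A polynomial in $\mathbb{R}[x]$ is called hyperbolic if all its zeros are real. For a hyperbolic $p$, $\operatorname{mesh}(p)$ is the minimal distance between its roots; if $p$ has a multiple root, then $\operatorname{mesh}(p):=0$; polynomials of degree at most $1$ are defined to have mesh $+\infty$. $\mathcal{HP}^{+}_{\ge 1}$ denotes the set of hyperbolic polynomials with mesh at least $1$ and with only non-negative zeros; by convention the zero polynomial and the nonzero constants belong to it. The Pochhammer polynomials are $(x)_0=1$, $(x)_i=x(x-1)\cdots(x-i+1)$ for $i\ge 1$. A real sequence $\{\alpha_i\}_{i=0}^\infty$ is called a discrete multiplier sequence if the linear operator $T:\mathbb{R}[x]\to\mathbb{R}[x]$ determined by $T((x)_i)=\alpha_i (x)_i$ for all $i\ge 0$ satisfies $T(\mathcal{HP}^{+}_{\ge 1})\subseteq\mathcal{HP}^{+}_{\ge 1}$. *)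

theory Defs
  imports
    "HOL-Computational_Algebra.Computational_Algebra"
    "HOL-Library.Extended_Real"
begin

(* Zeros are taken in the complex numbers; the zero polynomial is not hyperbolic here. *)
definition hyperbolic :: "real poly \<Rightarrow> bool" where
  "hyperbolic p \<longleftrightarrow> (\<forall>z::complex. poly (map_poly of_real p) z = 0 \<longrightarrow> z \<in> \<real>)"

definition multiple_root :: "real poly \<Rightarrow> real \<Rightarrow> bool" where
  "multiple_root p x \<longleftrightarrow> order x p \<ge> 2"

(* Meaningful for hyperbolic p, where the infimum runs over a finite nonempty set and is
   therefore attained. *)
definition mesh :: "real poly \<Rightarrow> ereal" where
  "mesh p =
     (if degree p \<le> 1 then \<infinity>
      else if \<exists>x. multiple_root p x then 0
      else Inf {ereal \<bar>x - y\<bar> | x y. poly p x = 0 \<and> poly p y = 0 \<and> x \<noteq> y})"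

(* Only the zero polynomial needs to be added by convention: nonzero constants have no zeros
   and infinite mesh, so they satisfy the second disjunct. *)
definition HP_plus_ge1 :: "real poly set" where
  "HP_plus_ge1 =
     {p. p = 0 \<or> (hyperbolic p \<and> mesh p \<ge> 1 \<and> (\<forall>x. poly p x = 0 \<longrightarrow> 0 \<le> x))}"

(* The falling factorial x (x - 1) ... (x - i + 1); the library's pochhammer is the rising one. *)
definition pochhammer_poly :: "nat \<Rightarrow> real poly" where
  "pochhammer_poly i = (\<Prod>j<i. [:- real j, 1:])"

definition diagonal_in_pochhammer :: "(nat \<Rightarrow> real) \<Rightarrow> (real poly \<Rightarrow> real poly) \<Rightarrow> bool" where
  "diagonal_in_pochhammer \<alpha> T \<longleftrightarrow>
     Vector_Spaces.linear smult smult T \<and>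
     (\<forall>i. T (pochhammer_poly i) = smult (\<alpha> i) (pochhammer_poly i))"

(* Well-defined by diagonal_in_pochhammer_ex1 below. *)
definition multiplier_operator :: "(nat \<Rightarrow> real) \<Rightarrow> real poly \<Rightarrow> real poly" where
  "multiplier_operator \<alpha> = (THE T. diagonal_in_pochhammer \<alpha> T)"

definition discrete_multiplier_sequence :: "(nat \<Rightarrow> real) \<Rightarrow> bool" where
  "discrete_multiplier_sequence \<alpha> \<longleftrightarrow> multiplier_operator \<alpha> ` HP_plus_ge1 \<subseteq> HP_plus_ge1"

definition trivial_sequence :: "(nat \<Rightarrow> real) \<Rightarrow> bool" where
  "trivial_sequence \<alpha> \<longleftrightarrow> finite {i. \<alpha> i \<noteq> 0} \<and> card {i. \<alpha> i \<noteq> 0} \<le> 2"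

lemma pochhammer_poly_0 [simp]: "pochhammer_poly 0 = 1"
  by (simp add: pochhammer_poly_def)

lemma pochhammer_poly_Suc:
  "pochhammer_poly (Suc i) = pochhammer_poly i * [:- real i, 1:]"
  by (simp add: pochhammer_poly_def)

lemma degree_lead_coeff_pochhammer_poly:
  "degree (pochhammer_poly i) = i \<and> lead_coeff (pochhammer_poly i) = 1"
proof (induction i)
  case (Suc i)
  hence "pochhammer_poly i \<noteq> 0" by auto
  hence d: "degree (pochhammer_poly (Suc i)) = Suc i"
    using Suc by (simp add: pochhammer_poly_Suc degree_mult_eq del: mult_pCons_right)
  have "lead_coeff (pochhammer_poly (Suc i)) = 1"
    unfolding pochhammer_poly_Suc lead_coeff_mult by (simp only: Suc.IH[THEN conjunct2]) simp
  with d show ?case by blast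
qed simp

lemma degree_pochhammer_poly [simp]: "degree (pochhammer_poly i) = i"
  using degree_lead_coeff_pochhammer_poly by blast

lemma coeff_pochhammer_poly_self [simp]: "coeff (pochhammer_poly i) i = 1"
  by (rule conjunct2[OF degree_lead_coeff_pochhammer_poly[of i], unfolded degree_pochhammer_poly])

interpretation poly_vs: vector_space_pair
  "smult :: real \<Rightarrow> real poly \<Rightarrow> real poly" "smult :: real \<Rightarrow> real poly \<Rightarrow> real poly"
  by unfold_locales (simp_all add: smult_add_right smult_add_left)

lemma inj_pochhammer_poly: "inj pochhammer_poly"
  by (metis degree_pochhammer_poly injI)

lemma independent_pochhammer_poly: "poly_vs.vs1.independent (range pochhammer_poly)"
proof -
  have "u v = 0" if fin: "finite S" and S: "S \<subseteq> range pochhammer_poly"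
      and eq: "(\<Sum>v\<in>S. smult (u v) v) = 0" and v: "v \<in> S" for S u v
  proof (rule ccontr)
    assume "u v \<noteq> 0"
    define A where "A = {w \<in> S. u w \<noteq> 0}"
    define n where "n = Max (degree ` A)"
    have A: "finite A" "A \<noteq> {}" using fin v \<open>u v \<noteq> 0\<close> by (auto simp: A_def)
    hence "n \<in> degree ` A" unfolding n_def by (intro Max_in) auto
    then obtain w where w: "w \<in> A" "degree w = n" by auto
    have le: "degree x \<le> n" if "x \<in> A" for x using A that by (simp add: n_def)
    have wn: "w = pochhammer_poly n" using w S by (auto simp: A_def)
    have z: "u x * coeff x n = 0" if "x \<in> S - {w}" for x
    proof (cases "x \<in> A")
      case True
      have "x \<in> range pochhammer_poly" using True S by (auto simp: A_def)
      then obtain k where k: "x = pochhammer_poly k" by blast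
      have "k \<le> n" "k \<noteq> n" using le[OF True] k that wn by auto
      thus ?thesis using k by (simp add: coeff_eq_0)
    qed (use that in \<open>auto simp: A_def\<close>)
    have "0 = coeff (\<Sum>v\<in>S. smult (u v) v) n" by (simp add: eq)
    also have "\<dots> = (\<Sum>v\<in>S. u v * coeff v n)" by (simp add: coeff_sum)
    also have "\<dots> = u w * coeff w n + (\<Sum>v\<in>S - {w}. u v * coeff v n)"
      using w by (intro sum.remove fin) (simp add: A_def)
    also have "(\<Sum>v\<in>S - {w}. u v * coeff v n) = 0"
      by (rule sum.neutral) (use z in blast)
    also have "u w * coeff w n + 0 = u w" by (simp add: wn)
    finally show False using w by (simp add: A_def)
  qed
  thus ?thesis unfolding poly_vs.vs1.dependent_explicit by blast
qed

lemma span_pochhammer_poly: "poly_vs.vs1.span (range pochhammer_poly) = UNIV"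
proof -
  have "p \<in> poly_vs.vs1.span (range pochhammer_poly)" if "degree p < n" for p n
    using that
  proof (induction n arbitrary: p)
    case (Suc n)
    define q where "q = p - smult (coeff p n) (pochhammer_poly n)"
    have q: "q \<in> poly_vs.vs1.span (range pochhammer_poly)"
    proof (cases "q = 0")
      case True
      thus ?thesis by (simp add: poly_vs.vs1.span_zero)
    next
      case False
      have "degree q \<le> n"
        unfolding q_def using Suc.prems by (intro degree_diff_le) auto
      moreover have "coeff q n = 0" by (simp add: q_def)
      ultimately have "degree q < n"
        using False by (metis leading_coeff_0_iff le_neq_implies_less)
      thus ?thesis by (rule Suc.IH)
    qed
    have "q + smult (coeff p n) (pochhammer_poly n) \<in> poly_vs.vs1.span (range pochhammer_poly)"
      by (intro poly_vs.vs1.span_add q poly_vs.vs1.span_scale poly_vs.vs1.span_base) simp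
    thus ?case by (simp add: q_def)
  qed simp
  thus ?thesis by blast
qed

lemma diagonal_in_pochhammer_ex1: "\<exists>!T. diagonal_in_pochhammer \<alpha> T"
proof (rule ex_ex1I)
  obtain T where "Vector_Spaces.linear smult smult T"
    "\<forall>x\<in>range pochhammer_poly. T x = smult (\<alpha> (degree x)) x"
    using poly_vs.linear_independent_extend[OF independent_pochhammer_poly,
        of "\<lambda>x. smult (\<alpha> (degree x)) x"] by blast
  hence "diagonal_in_pochhammer \<alpha> T" by (simp add: diagonal_in_pochhammer_def)
  thus "\<exists>T. diagonal_in_pochhammer \<alpha> T" by blast
next
  fix T T' assume TT: "diagonal_in_pochhammer \<alpha> T" "diagonal_in_pochhammer \<alpha> T'"
  show "T = T'"
  proof
    fix p
    show "T p = T' p"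
      by (rule poly_vs.linear_eq_on[where B = "range pochhammer_poly"])
        (use TT in \<open>auto simp: diagonal_in_pochhammer_def span_pochhammer_poly\<close>)
  qed
qed

lemma diagonal_multiplier_operator: "diagonal_in_pochhammer \<alpha> (multiplier_operator \<alpha>)"
  unfolding multiplier_operator_def by (rule theI'[OF diagonal_in_pochhammer_ex1])

end

theory Submission
  imports Defs
begin

text \<open>
  A nonzero polynomial of \<^const>\<open>HP_plus_ge1\<close> is a constant times a product of linear factors
  \<open>x - r\<^sub>0\<close>, ..., \<open>x - r\<^sub>n\<^sub>-\<^sub>1\<close> whose roots, listed in increasing order, start at or above zero
  and advance in steps of at least one (\<open>HP_plus_ge1_factorization\<close>). Consequently
  \<open>k \<le> r\<^sub>k\<close>, and this inequality drives the sign analysis.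

  Writing the product in the basis \<open>(x)\<^sub>k\<close> gives its Newton coefficients \<open>c\<^sub>k\<close>. Since
  \<open>(x)\<^sub>k (x - r) = (x)\<^sub>k\<^sub>+\<^sub>1 + (k - r) (x)\<^sub>k\<close>, appending the factor \<open>x - r\<^sub>n\<close> to a product of \<open>n\<close>
  factors turns \<open>c\<^sub>k\<close> into \<open>c\<^sub>k\<^sub>-\<^sub>1 + (k - r\<^sub>n) c\<^sub>k\<close>, where \<open>k \<le> n \<le> r\<^sub>n\<close>. Taking the roots in increasing
  order thus never produces a cancellation: the coefficients alternate in sign
  (\<open>newton_coeff_alternating\<close>), strictly so if \<open>k < r\<^sub>k\<close> throughout. For the same reason the
  coefficient below the leading one is a sum of the nonpositive numbers \<open>k - r\<^sub>k\<close>; if it vanishes,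
  the roots are \<open>0, ..., n - 1\<close> and all lower coefficients vanish too
  (\<open>newton_coeff_subleading_eq_0\<close>).

  Both directions are read off from these signs. If \<open>\<alpha>\<close> lives on \<open>{m, m + 1}\<close>, the image of a
  polynomial is \<open>(x)\<^sub>m (a + b (x - m))\<close> with \<open>a = \<alpha>\<^sub>m c\<^sub>m\<close>, \<open>b = \<alpha>\<^sub>m\<^sub>+\<^sub>1 c\<^sub>m\<^sub>+\<^sub>1\<close> and \<open>a b = \<alpha>\<^sub>m \<alpha>\<^sub>m\<^sub>+\<^sub>1 c\<^sub>m c\<^sub>m\<^sub>+\<^sub>1 \<le> 0\<close>, so for \<open>b \<noteq> 0\<close>
  its last root \<open>m - a / b\<close> is at least \<open>m\<close> and the spacing is kept. Conversely, suppose that \<open>\<alpha>\<close> is nonzero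
  exactly at \<open>i < j\<close>. The polynomial with roots \<open>1, ..., j\<close> has strictly alternating
  coefficients, and its image has degree \<open>j\<close> and nonzero coefficients only at \<open>i\<close> and \<open>j\<close>. A gap
  between \<open>i\<close> and \<open>j\<close> would make the coefficient at \<open>j - 1\<close> zero and the one at \<open>i\<close> nonzero, which
  is impossible; and if \<open>j = i + 1\<close>, alternation before and after applying the operator forces
  \<open>\<alpha>\<^sub>i \<alpha>\<^sub>j \<ge> 0\<close>.
\<close>

section \<open>Factored form of the polynomials of mesh at least one\<close>

definition poly_with_roots :: "(nat \<Rightarrow> real) \<Rightarrow> nat \<Rightarrow> real poly" where
  "poly_with_roots r n = (\<Prod>k<n. [:- r k, 1:])"

text \<open>
  The spacing is required between all pairs, not just neighbours, so that appending one more root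
  asks for its distance to every earlier one and needs no case split on an empty list of roots.
\<close>

definition unit_spaced :: "(nat \<Rightarrow> real) \<Rightarrow> nat \<Rightarrow> bool" where
  "unit_spaced r n \<longleftrightarrow> (\<forall>i<n. 0 \<le> r i) \<and> (\<forall>j<n. \<forall>i<j. r i + 1 \<le> r j)"

lemma pochhammer_poly_eq_poly_with_roots: "pochhammer_poly = poly_with_roots real"
  by (simp add: fun_eq_iff pochhammer_poly_def poly_with_roots_def)

lemma poly_with_roots_0 [simp]: "poly_with_roots r 0 = 1"
  by (simp add: poly_with_roots_def)

lemma poly_with_roots_Suc:
  "poly_with_roots r (Suc n) = poly_with_roots r n * [:- r n, 1:]"
  by (simp add: poly_with_roots_def)

lemma poly_with_roots_cong:
  "(\<And>k. k < n \<Longrightarrow> r k = s k) \<Longrightarrow> poly_with_roots r n = poly_with_roots s n"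
  by (simp add: poly_with_roots_def)

lemma poly_with_roots_nonzero [simp]: "poly_with_roots r n \<noteq> 0"
  by (simp add: poly_with_roots_def)

lemma poly_poly_with_roots_eq_0_iff: "poly (poly_with_roots r n) x = 0 \<longleftrightarrow> (\<exists>k<n. x = r k)"
  by (auto simp: poly_with_roots_def poly_prod)

lemma unit_spaced_lower_bound:
  assumes "unit_spaced r n" and "k < n"
  shows "real k \<le> r k"
  using assms(2)
proof (induction k)
  case 0
  thus ?case using assms(1) by (simp add: unit_spaced_def)
next
  case (Suc k)
  have "r k + 1 \<le> r (Suc k)"
    using assms(1) Suc.prems by (simp add: unit_spaced_def)
  with Suc show ?case by simp
qed

lemma order_linear_factor: "order x [:- a, 1:] = (if x = a then 1 else 0)" for a :: real
  using order_power_n_n[of a 1] by (auto intro: order_0I)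

lemma order_poly_with_roots_le_1:
  assumes "unit_spaced r n"
  shows "order x (poly_with_roots r n) \<le> 1"
  using assms
proof (induction n)
  case (Suc n)
  have us: "unit_spaced r n" using Suc.prems by (simp add: unit_spaced_def)
  have "order x (poly_with_roots r (Suc n)) = order x (poly_with_roots r n) + order x [:- r n, 1:]"
    unfolding poly_with_roots_Suc
    by (rule order_mult) (simp only: mult_eq_0_iff poly_with_roots_nonzero, simp)
  moreover have "order (r n) (poly_with_roots r n) = 0"
  proof (rule order_0I)
    have "r n \<noteq> r k" if "k < n" for k
      using Suc.prems that unfolding unit_spaced_def by (metis add_le_same_cancel1 lessI not_one_le_zero)
    thus "poly (poly_with_roots r n) (r n) \<noteq> 0"
      by (auto simp: poly_poly_with_roots_eq_0_iff)
  qed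
  ultimately show ?case using Suc.IH[OF us] by (auto simp: order_linear_factor)
qed simp

lemma map_poly_of_real_mult:
  "map_poly of_real (p * q) = (map_poly of_real p * map_poly of_real q :: complex poly)"
  by (rule poly_eqI) (simp add: coeff_map_poly coeff_mult)

lemma hyperbolic_mult_iff: "hyperbolic (p * q) \<longleftrightarrow> hyperbolic p \<and> hyperbolic q"
  by (auto simp: hyperbolic_def map_poly_of_real_mult)

lemma hyperbolic_linear_factor: "hyperbolic [:- a, 1:]"
  by (auto simp: hyperbolic_def map_poly_pCons)

lemma hyperbolic_const: "c \<noteq> 0 \<Longrightarrow> hyperbolic [:c:]"
  by (auto simp: hyperbolic_def map_poly_pCons)

lemma hyperbolic_poly_with_roots: "hyperbolic (poly_with_roots r n)"
proof (induction n)
  case 0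
  thus ?case using hyperbolic_const[of 1] by (simp add: one_pCons)
qed (simp only: poly_with_roots_Suc hyperbolic_mult_iff hyperbolic_linear_factor)

text \<open>
  The mesh of a polynomial is unwieldy under division by a linear factor, since its defining cases
  depend on the degree. The two conditions here visibly pass to divisors and make no mention of the
  degree; the case of degree at most one is absorbed because such a polynomial has neither a
  multiple root nor two distinct ones.
\<close>

lemma mesh_ge_1_iff:
  assumes "p \<noteq> 0"
  shows "mesh p \<ge> 1 \<longleftrightarrow>
    (\<forall>x. order x p \<le> 1) \<and> (\<forall>x y. poly p x = 0 \<longrightarrow> poly p y = 0 \<longrightarrow> x \<noteq> y \<longrightarrow> 1 \<le> \<bar>x - y\<bar>)"
proof (cases "degree p \<le> 1")
  case True
  have "card {x. poly p x = 0} \<le> 1"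
    using card_poly_roots_bound[OF assms] True by simp
  hence "x = y" if "poly p x = 0" "poly p y = 0" for x y
    using that poly_roots_finite[OF assms] by (auto simp: card_le_Suc0_iff_eq)
  moreover have "order x p \<le> 1" for x
    using order_degree[OF assms, of x] True by simp
  moreover have "mesh p \<ge> 1" using True by (simp add: mesh_def)
  ultimately show ?thesis by blast
next
  case False
  show ?thesis
  proof (cases "\<exists>x. multiple_root p x")
    case True
    hence "\<not> mesh p \<ge> 1" using False by (simp add: mesh_def)
    moreover have "\<exists>x. \<not> order x p \<le> 1"
      using True by (auto simp: multiple_root_def not_le Suc_le_eq numeral_2_eq_2)
    ultimately show ?thesis by blast
  next
    case simple: False
    hence "order x p \<le> 1" for x by (metis multiple_root_def not_less_eq_eq numeral_2_eq_2 One_nat_def)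
    moreover
    have mesh: "mesh p = Inf {ereal \<bar>x - y\<bar> | x y. poly p x = 0 \<and> poly p y = 0 \<and> x \<noteq> y}"
      unfolding mesh_def if_not_P[OF False] if_not_P[OF simple] ..
    have "1 \<le> \<bar>x - y\<bar>" if "mesh p \<ge> 1" "poly p x = 0" "poly p y = 0" "x \<noteq> y" for x y
    proof -
      have "mesh p \<le> ereal \<bar>x - y\<bar>"
        unfolding mesh by (rule Inf_lower) (use that in blast)
      with that(1) have "1 \<le> ereal \<bar>x - y\<bar>" by (rule order_trans)
      thus ?thesis by simp
    qed
    moreover have "mesh p \<ge> 1"
      if "\<forall>x y. poly p x = 0 \<longrightarrow> poly p y = 0 \<longrightarrow> x \<noteq> y \<longrightarrow> 1 \<le> \<bar>x - y\<bar>"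
      unfolding mesh by (rule Inf_greatest) (use that in auto)
    ultimately show ?thesis by blast
  qed
qed

lemma HP_plus_ge1_iff:
  assumes "p \<noteq> 0"
  shows "p \<in> HP_plus_ge1 \<longleftrightarrow>
    hyperbolic p \<and> (\<forall>x. order x p \<le> 1) \<and>
    (\<forall>x y. poly p x = 0 \<longrightarrow> poly p y = 0 \<longrightarrow> x \<noteq> y \<longrightarrow> 1 \<le> \<bar>x - y\<bar>) \<and>
    (\<forall>x. poly p x = 0 \<longrightarrow> 0 \<le> x)"
  using assms by (auto simp: HP_plus_ge1_def mesh_ge_1_iff)

lemma smult_poly_with_roots_in_HP_plus_ge1:
  assumes us: "unit_spaced r n"
  shows "smult c (poly_with_roots r n) \<in> HP_plus_ge1"
proof (cases "c = 0")
  case True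
  thus ?thesis by (simp add: HP_plus_ge1_def)
next
  case False
  have "hyperbolic (smult c (poly_with_roots r n))"
    using hyperbolic_mult_iff[of "[:c:]"] hyperbolic_const[OF False] hyperbolic_poly_with_roots
    by simp
  moreover have "1 \<le> \<bar>r i - r j\<bar>" if "i < n" "j < n" "r i \<noteq> r j" for i j
  proof -
    have "i \<noteq> j" using that by auto
    thus ?thesis
      using us that unfolding unit_spaced_def by (smt (verit) nat_neq_iff)
  qed
  ultimately show ?thesis
    using False us order_poly_with_roots_le_1[OF us]
    by (auto simp: HP_plus_ge1_iff poly_poly_with_roots_eq_0_iff order_smult unit_spaced_def)
qed

lemma hyperbolic_has_real_root:
  assumes "hyperbolic p" and "degree p > 0"
  shows "\<exists>x. poly p x = 0"
proof -
  have "degree (map_poly of_real p :: complex poly) = degree p"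
    by (rule degree_map_poly) simp
  hence "\<not> constant (poly (map_poly of_real p :: complex poly))"
    using assms(2) by (simp add: constant_degree)
  then obtain z :: complex where z: "poly (map_poly of_real p) z = 0"
    using fundamental_theorem_of_algebra by blast
  then obtain x where "z = of_real x"
    using assms(1) by (auto simp: hyperbolic_def Reals_def)
  have "(of_real (poly p x) :: complex) = poly (map_poly of_real p) (of_real x)"
    by (induction p) (auto simp: map_poly_pCons)
  with z \<open>z = of_real x\<close> show ?thesis by auto
qed

text \<open>
  Splitting off the \<^emph>\<open>largest\<close> root at each step delivers the roots in increasing order, which the
  sign analysis below depends on.
\<close>

lemma HP_plus_ge1_factorization:
  assumes "p \<in> HP_plus_ge1" and "p \<noteq> 0"
  obtains c r n where "c \<noteq> 0" and "unit_spaced r n" and "p = smult c (poly_with_roots r n)"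
proof -
  have "\<exists>c r. c \<noteq> 0 \<and> unit_spaced r n \<and> p = smult c (poly_with_roots r n)"
    if "p \<in> HP_plus_ge1" "p \<noteq> 0" "degree p = n" for p n
    using that
  proof (induction n arbitrary: p)
    case 0
    then obtain c where "p = [:c:]" by (auto elim: degree_eq_zeroE)
    with 0 show ?case
      by (intro exI[of _ c] exI[of _ real]) (auto simp: unit_spaced_def)
  next
    case (Suc n)
    note HP = Suc.prems(1)[unfolded HP_plus_ge1_iff[OF \<open>p \<noteq> 0\<close>]]
    let ?R = "{x. poly p x = 0}"
    have fin: "finite ?R" using \<open>p \<noteq> 0\<close> by (rule poly_roots_finite)
    have "?R \<noteq> {}" using hyperbolic_has_real_root[of p] HP Suc.prems(3) by auto
    define t where "t = Max ?R"
    have t: "poly p t = 0" using Max_in[OF fin \<open>?R \<noteq> {}\<close>] by (simp add: t_def)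
    have t_max: "x \<le> t" if "poly p x = 0" for x using fin that by (simp add: t_def)
    obtain q where pq: "p = [:- t, 1:] * q"
      using t by (auto simp: poly_eq_0_iff_dvd dvd_def)
    have q0: "q \<noteq> 0" using pq \<open>p \<noteq> 0\<close> by auto
    have ord: "order x p = order x [:- t, 1:] + order x q" for x
      unfolding pq by (rule order_mult) (use pq \<open>p \<noteq> 0\<close> in blast)
    have "order t p = 1 + order t q" using ord[of t] by (simp add: order_linear_factor)
    hence t_simple: "order t q = 0" using HP by (metis add_le_same_cancel1 le_zero_eq)
    have q_root: "poly p x = 0" if "poly q x = 0" for x using that by (simp add: pq)
    have "degree q = n" using Suc.prems(3) q0 by (simp add: pq degree_mult_eq del: mult_pCons_left)
    moreover have "q \<in> HP_plus_ge1"
    proof -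
      have "order x q \<le> 1" for x using HP ord[of x] by (metis add_leD2)
      moreover have "hyperbolic q" using HP unfolding pq hyperbolic_mult_iff by blast
      ultimately show ?thesis using HP q_root by (simp add: HP_plus_ge1_iff[OF q0])
    qed
    ultimately obtain c r where c: "c \<noteq> 0" and us: "unit_spaced r n"
      and q: "q = smult c (poly_with_roots r n)"
      using Suc.IH[of q] q0 by blast
    have far: "r i + 1 \<le> t" if "i < n" for i
    proof -
      have "poly q (r i) = 0" using that by (auto simp: q poly_poly_with_roots_eq_0_iff)
      moreover from this have "r i \<noteq> t" using t_simple q0 by (auto simp: order_root)
      ultimately show ?thesis using HP t t_max[of "r i"] q_root[of "r i"] by force
    qed
    have "0 \<le> t" using HP t by blast
    have "unit_spaced (r(n := t)) (Suc n)"
      using us far \<open>0 \<le> t\<close> by (auto simp: unit_spaced_def less_Suc_eq)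
    moreover have "poly_with_roots (r(n := t)) n = poly_with_roots r n"
      by (rule poly_with_roots_cong) simp
    hence "p = smult c (poly_with_roots (r(n := t)) (Suc n))"
      by (simp add: pq q poly_with_roots_Suc mult.commute del: mult_pCons_left mult_pCons_right)
    ultimately show ?case using c by blast
  qed
  with assms that show thesis by blast
qed

section \<open>Newton coefficients\<close>

text \<open>
  The coefficient of \<open>(x)\<^sub>k\<close> in the product of the first \<open>n\<close> linear factors. It is also the divided
  difference of that product at \<open>0, ..., k\<close>, but only the recurrence in \<open>n\<close> exposes the signs.
\<close>

fun newton_coeff :: "(nat \<Rightarrow> real) \<Rightarrow> nat \<Rightarrow> nat \<Rightarrow> real" where
  "newton_coeff r 0 k = (if k = 0 then 1 else 0)"
| "newton_coeff r (Suc n) k =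
     (if k = 0 then 0 else newton_coeff r n (k - 1)) + (real k - r n) * newton_coeff r n k"

lemma newton_coeff_eq_0: "n < k \<Longrightarrow> newton_coeff r n k = 0"
  by (induction n arbitrary: k) auto

lemma newton_coeff_self: "newton_coeff r n n = 1"
  by (induction n) (auto simp: newton_coeff_eq_0)

lemma pochhammer_poly_mult_linear_factor:
  "pochhammer_poly k * [:- a, 1:] = pochhammer_poly (Suc k) + smult (real k - a) (pochhammer_poly k)"
proof -
  have "[:- a, 1:] = [:- real k, 1:] + [:real k - a:]" by simp
  thus ?thesis by (simp only: pochhammer_poly_Suc distrib_left) simp
qed

lemma poly_with_roots_newton_expansion:
  assumes "n \<le> N"
  shows "poly_with_roots r n = (\<Sum>k\<le>N. smult (newton_coeff r n k) (pochhammer_poly k))"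
proof -
  have "poly_with_roots r n = (\<Sum>k\<le>n. smult (newton_coeff r n k) (pochhammer_poly k))"
  proof (induction n)
    case (Suc n)
    let ?P = pochhammer_poly and ?c = "newton_coeff r n"
    have "poly_with_roots r (Suc n) = (\<Sum>k\<le>n. smult (?c k) (?P k * [:- r n, 1:]))"
      unfolding poly_with_roots_Suc Suc.IH sum_distrib_right by (simp only: mult_smult_left)
    also have "\<dots> = (\<Sum>k\<le>n. smult (?c k) (?P (Suc k))) + (\<Sum>k\<le>n. smult ((real k - r n) * ?c k) (?P k))"
      unfolding pochhammer_poly_mult_linear_factor
      by (simp add: smult_add_right sum.distrib mult.commute)
    also have "(\<Sum>k\<le>n. smult (?c k) (?P (Suc k))) =
        (\<Sum>k\<le>Suc n. smult (if k = 0 then 0 else ?c (k - 1)) (?P k))"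
      by (subst sum.atMost_Suc_shift) simp
    also have "(\<Sum>k\<le>n. smult ((real k - r n) * ?c k) (?P k)) =
        (\<Sum>k\<le>Suc n. smult ((real k - r n) * ?c k) (?P k))"
      by (simp add: newton_coeff_eq_0)
    finally show ?case by (simp add: sum.distrib[symmetric] smult_add_left)
  qed simp
  also have "\<dots> = (\<Sum>k\<le>N. smult (newton_coeff r n k) (pochhammer_poly k))"
    by (rule sum.mono_neutral_left) (use assms in \<open>auto simp: newton_coeff_eq_0\<close>)
  finally show ?thesis .
qed

lemma smult_sum_right: "smult c (\<Sum>k\<in>A. f k) = (\<Sum>k\<in>A. smult c (f k))" for c :: real
  by (rule poly_vs.vs1.scale_sum_right)

lemma pochhammer_expansion_unique:
  assumes "(\<Sum>k\<le>N. smult (f k) (pochhammer_poly k)) = (\<Sum>k\<le>N. smult (g k) (pochhammer_poly k))"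
    and "k \<le> N"
  shows "f k = g k"
  using assms
proof (induction N)
  case (Suc N)
  have top: "coeff (\<Sum>k\<le>Suc N. smult (h k) (pochhammer_poly k)) (Suc N) = h (Suc N)" for h
    using coeff_pochhammer_poly_self[of "Suc N"] by (simp add: coeff_sum coeff_eq_0)
  have "f (Suc N) = g (Suc N)" using top[of f] top[of g] unfolding Suc.prems(1) by simp
  with Suc show ?case by (cases "k = Suc N") auto
qed simp

text \<open>
  Both summands of the recurrence carry the sign \<open>(-1)\<^sup>n\<^sup>+\<^sup>1\<^sup>+\<^sup>k\<close>: the first because \<open>n\<close> and \<open>k\<close> drop
  together, the second because its factor \<open>k - r\<^sub>n\<close> is nonpositive wherever the coefficient is
  nonzero.
\<close>

lemma newton_coeff_alternating:
  assumes "\<And>k. k < n \<Longrightarrow> real k \<le> r k"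
  shows "0 \<le> (- 1) ^ (n + k) * newton_coeff r n k"
  using assms
proof (induction n arbitrary: k)
  case (Suc n)
  have IH: "0 \<le> (- 1) ^ (n + j) * newton_coeff r n j" for j
    using Suc.IH Suc.prems by simp
  have "0 \<le> (- 1) ^ (Suc n + k) * (if k = 0 then 0 else newton_coeff r n (k - 1))"
    using IH[of "k - 1"] by (cases k) auto
  moreover have "0 \<le> (- 1) ^ (Suc n + k) * ((real k - r n) * newton_coeff r n k)"
  proof (cases "k \<le> n")
    case True
    hence "0 \<le> (r n - real k) * ((- 1) ^ (n + k) * newton_coeff r n k)"
      using Suc.prems[of n] by (intro mult_nonneg_nonneg IH) simp
    thus ?thesis by (simp add: algebra_simps)
  qed (simp add: newton_coeff_eq_0)
  ultimately show ?case by (simp add: distrib_left)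
qed simp

text \<open>
  With strict inequalities the second summand of the recurrence is already nonzero below the leading
  index, and the first one cannot cancel it.
\<close>

lemma newton_coeff_strictly_alternating:
  assumes "\<And>k. k < n \<Longrightarrow> real k < r k" and "k \<le> n"
  shows "0 < (- 1) ^ (n + k) * newton_coeff r n k"
  using assms
proof (induction n arbitrary: k)
  case (Suc n)
  show ?case
  proof (cases "k = Suc n")
    case True
    thus ?thesis by (simp add: newton_coeff_self del: newton_coeff.simps)
  next
    case False
    have "0 \<le> (- 1) ^ (n + j) * newton_coeff r n j" for j
      using Suc.prems(1) by (intro newton_coeff_alternating) (simp add: less_imp_le)
    hence "0 \<le> (- 1) ^ (Suc n + k) * (if k = 0 then 0 else newton_coeff r n (k - 1))"
      by (cases k) auto
    moreover have "0 < (r n - real k) * ((- 1) ^ (n + k) * newton_coeff r n k)"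
    proof (rule mult_pos_pos)
      show "0 < (- 1) ^ (n + k) * newton_coeff r n k"
        using Suc False by simp
      show "0 < r n - real k"
        using Suc.prems(1)[of n] Suc.prems(2) False by simp
    qed
    hence "0 < (- 1) ^ (Suc n + k) * ((real k - r n) * newton_coeff r n k)"
      by (simp add: algebra_simps)
    ultimately show ?thesis by (simp add: distrib_left)
  qed
qed simp

lemma newton_coeff_consecutive_nonpos:
  assumes "\<And>k. k < n \<Longrightarrow> real k \<le> r k"
  shows "newton_coeff r n k * newton_coeff r n (Suc k) \<le> 0"
proof -
  have "0 \<le> ((- 1) ^ (n + k) * newton_coeff r n k) * ((- 1) ^ (n + Suc k) * newton_coeff r n (Suc k))"
    by (intro mult_nonneg_nonneg newton_coeff_alternating assms)
  also have "\<dots> = - (((- 1) ^ (n + k)) ^ 2 * (newton_coeff r n k * newton_coeff r n (Suc k)))"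
    by (simp add: power2_eq_square algebra_simps)
  also have "((- 1 :: real) ^ (n + k)) ^ 2 = 1" by (simp flip: power_mult)
  finally show ?thesis by simp
qed

text \<open>
  The subleading coefficient is the sum of the numbers \<open>k - r\<^sub>k\<close>. These are nonpositive, so a zero
  sum makes each of them zero and the product is \<open>(x)\<^sub>n\<close>. This is what excludes gaps in the support
  of a multiplier sequence.
\<close>

lemma newton_coeff_subleading_eq_0:
  assumes "\<And>k. k < n \<Longrightarrow> real k \<le> r k"
    and "newton_coeff r n (n - 1) = 0" and "k < n"
  shows "newton_coeff r n k = 0"
  using assms
proof (induction n arbitrary: k)
  case (Suc n)
  have "newton_coeff r (Suc n) n =
      (if n = 0 then 0 else newton_coeff r n (n - 1)) + (real n - r n)"
    by (simp add: newton_coeff_self)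
  moreover have "(if n = 0 then 0 else newton_coeff r n (n - 1)) \<le> 0"
    using newton_coeff_consecutive_nonpos[of n r "n - 1"] Suc.prems(1)
    by (cases n) (auto simp: newton_coeff_self simp del: newton_coeff.simps)
  \<comment> \<open>Two nonpositive numbers with sum zero.\<close>
  ultimately have "r n = real n" and sub: "n = 0 \<or> newton_coeff r n (n - 1) = 0"
    using Suc.prems(1)[of n] Suc.prems(2) by (auto split: if_splits)
  have "newton_coeff r n j = 0" if "j < n" for j
    using Suc.IH[of j] Suc.prems(1) sub that by auto
  with \<open>r n = real n\<close> Suc.prems(3) show ?case by (cases "k = n") auto
qed simp

section \<open>Trivial discrete multiplier sequences\<close>

lemma multiplier_operator_newton:
  "multiplier_operator \<alpha> (\<Sum>k\<in>A. smult (c k) (pochhammer_poly k)) =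
     (\<Sum>k\<in>A. smult (\<alpha> k * c k) (pochhammer_poly k))"
proof -
  have T: "Vector_Spaces.linear smult smult (multiplier_operator \<alpha>)"
    and P: "multiplier_operator \<alpha> (pochhammer_poly i) = smult (\<alpha> i) (pochhammer_poly i)" for i
    using diagonal_multiplier_operator[of \<alpha>] by (auto simp: diagonal_in_pochhammer_def)
  show ?thesis
    by (simp add: poly_vs.linear_sum[OF T] poly_vs.linear_scale[OF T] P mult.commute)
qed

text \<open>
  The sum is \<open>(x)\<^sub>m (a + b (x - m))\<close>. For \<open>b \<noteq> 0\<close> the sign condition says that its remaining root
  \<open>m - a / b\<close> is at least \<open>m\<close>, hence one unit beyond the roots \<open>0, ..., m - 1\<close> of \<open>(x)\<^sub>m\<close>.
\<close>

lemma two_term_in_HP_plus_ge1: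
  assumes "a * b \<le> 0"
  shows "smult a (pochhammer_poly m) + smult b (pochhammer_poly (Suc m)) \<in> HP_plus_ge1"
proof (cases "b = 0")
  case True
  have "unit_spaced real m" by (auto simp: unit_spaced_def)
  thus ?thesis
    using True smult_poly_with_roots_in_HP_plus_ge1
    by (simp add: pochhammer_poly_eq_poly_with_roots)
next
  case False
  define t where "t = real m - a / b"
  have "a / b = a * b / b ^ 2" using False by (simp add: power2_eq_square)
  hence "a / b \<le> 0" using assms by (simp add: divide_nonpos_nonneg)
  hence "real m \<le> t" by (simp add: t_def)
  hence "unit_spaced (real(m := t)) (Suc m)"
    by (auto simp: unit_spaced_def less_Suc_eq)
  moreover have "poly_with_roots (real(m := t)) m = pochhammer_poly m"
    unfolding pochhammer_poly_eq_poly_with_roots by (rule poly_with_roots_cong) simp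
  hence "poly_with_roots (real(m := t)) (Suc m) = pochhammer_poly m * [:- t, 1:]"
    by (simp add: poly_with_roots_Suc)
  hence "smult b (poly_with_roots (real(m := t)) (Suc m)) =
      smult a (pochhammer_poly m) + smult b (pochhammer_poly (Suc m))"
    using False unfolding pochhammer_poly_mult_linear_factor
    by (simp add: smult_add_right t_def add.commute)
  ultimately show ?thesis using smult_poly_with_roots_in_HP_plus_ge1 by metis
qed

lemma discrete_multiplier_sequence_adjacent:
  assumes ab: "0 \<le> \<alpha> m * \<alpha> (Suc m)" and zero: "\<And>i. i \<notin> {m, Suc m} \<Longrightarrow> \<alpha> i = 0"
  shows "discrete_multiplier_sequence \<alpha>"
  unfolding discrete_multiplier_sequence_def
proof (rule image_subsetI)
  fix p assume p: "p \<in> HP_plus_ge1"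
  show "multiplier_operator \<alpha> p \<in> HP_plus_ge1"
  proof (cases "p = 0")
    case True
    thus ?thesis using multiplier_operator_newton[of \<alpha> _ "{}"] by (simp add: HP_plus_ge1_def)
  next
    case False
    then obtain c r n where us: "unit_spaced r n" and pr: "p = smult c (poly_with_roots r n)"
      using p HP_plus_ge1_factorization by blast
    define d where "d k = c * newton_coeff r n k" for k
    \<comment> \<open>A range reaching \<open>m + 1\<close> even when the degree of \<open>p\<close> is smaller.\<close>
    define N where "N = max n (Suc m)"
    have "p = (\<Sum>k\<le>N. smult (d k) (pochhammer_poly k))"
      using poly_with_roots_newton_expansion[of n N r]
      by (simp add: pr N_def smult_sum_right d_def)
    hence "multiplier_operator \<alpha> p = (\<Sum>k\<le>N. smult (\<alpha> k * d k) (pochhammer_poly k))"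
      by (simp add: multiplier_operator_newton)
    also have "\<dots> = (\<Sum>k\<in>{m, Suc m}. smult (\<alpha> k * d k) (pochhammer_poly k))"
      by (rule sum.mono_neutral_right) (use zero in \<open>auto simp: N_def\<close>)
    finally have Tp: "multiplier_operator \<alpha> p =
        smult (\<alpha> m * d m) (pochhammer_poly m) + smult (\<alpha> (Suc m) * d (Suc m)) (pochhammer_poly (Suc m))"
      by simp
    have "newton_coeff r n m * newton_coeff r n (Suc m) \<le> 0"
      using unit_spaced_lower_bound[OF us] by (rule newton_coeff_consecutive_nonpos)
    hence "(c ^ 2 * (\<alpha> m * \<alpha> (Suc m))) * (newton_coeff r n m * newton_coeff r n (Suc m)) \<le> 0"
      using ab by (intro mult_nonneg_nonpos[OF mult_nonneg_nonneg]) simp_all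
    hence "(\<alpha> m * d m) * (\<alpha> (Suc m) * d (Suc m)) \<le> 0"
      by (simp add: d_def power2_eq_square mult_ac)
    thus ?thesis unfolding Tp by (rule two_term_in_HP_plus_ge1)
  qed
qed

text \<open>
  The test polynomial must have nonzero coefficients at both \<open>i\<close> and \<open>j\<close>. The roots \<open>1, ..., j\<close> are
  the roots of \<open>(x)\<^sub>j\<close> moved off their minimal positions \<open>k \<le> r\<^sub>k\<close>, so that no coefficient vanishes,
  while the degree \<open>j\<close> makes the coefficient at \<open>j\<close> the leading one of the image.
\<close>

lemma discrete_multiplier_sequence_two_terms:
  assumes dms: "discrete_multiplier_sequence \<alpha>"
    and ij: "i < j" and nz: "\<alpha> i \<noteq> 0" "\<alpha> j \<noteq> 0"
    and zero: "\<And>k. k \<notin> {i, j} \<Longrightarrow> \<alpha> k = 0"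
  shows "j = Suc i \<and> 0 \<le> \<alpha> i * \<alpha> j"
proof -
  define r where "r k = real k + 1" for k
  define c where "c = newton_coeff r j"
  have c_sign: "0 < (- 1) ^ (j + k) * c k" if "k \<le> j" for k
    unfolding c_def using that by (intro newton_coeff_strictly_alternating) (auto simp: r_def)
  have "unit_spaced r j" by (auto simp: unit_spaced_def r_def)
  hence "poly_with_roots r j \<in> HP_plus_ge1"
    using smult_poly_with_roots_in_HP_plus_ge1[of r j 1] by simp
  define q where "q = multiplier_operator \<alpha> (poly_with_roots r j)"
  have q_HP: "q \<in> HP_plus_ge1"
    using dms \<open>poly_with_roots r j \<in> HP_plus_ge1\<close>
    by (auto simp: discrete_multiplier_sequence_def q_def)
  have q_exp: "q = (\<Sum>k\<le>N. smult (\<alpha> k * c k) (pochhammer_poly k))" if "j \<le> N" for N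
    unfolding q_def c_def poly_with_roots_newton_expansion[OF that] multiplier_operator_newton ..
  have cj: "\<alpha> j * c j \<noteq> 0" using nz by (simp add: c_def newton_coeff_self)
  have "q \<noteq> 0"
  proof
    assume "q = 0"
    hence "(\<Sum>k\<le>j. smult (\<alpha> k * c k) (pochhammer_poly k)) = (\<Sum>k\<le>j. smult 0 (pochhammer_poly k))"
      using q_exp[of j] by simp
    from pochhammer_expansion_unique[OF this, of j] cj show False by simp
  qed
  then obtain b s n where b: "b \<noteq> 0" and us: "unit_spaced s n"
    and qs: "q = smult b (poly_with_roots s n)"
    using q_HP HP_plus_ge1_factorization by blast
  define N where "N = max j n"
  have expansions: "(\<Sum>k\<le>N. smult (\<alpha> k * c k) (pochhammer_poly k)) =
      (\<Sum>k\<le>N. smult (b * newton_coeff s n k) (pochhammer_poly k))"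
  proof -
    have "j \<le> N" "n \<le> N" by (simp_all add: N_def)
    thus ?thesis
      unfolding q_exp[OF \<open>j \<le> N\<close>, symmetric] qs poly_with_roots_newton_expansion[OF \<open>n \<le> N\<close>]
      by (simp add: smult_sum_right)
  qed
  have coeffs: "\<alpha> k * c k = b * newton_coeff s n k" if "k \<le> N" for k
    using pochhammer_expansion_unique[OF expansions that] .
  \<comment> \<open>Each side has its last nonzero coefficient at its own degree.\<close>
  have "n = j"
  proof (rule ccontr)
    assume "n \<noteq> j"
    then consider "n < j" | "j < n" by linarith
    thus False
    proof cases
      case 1
      thus False using coeffs[of j] cj by (simp add: N_def newton_coeff_eq_0)
    next
      case 2
      thus False using coeffs[of n] b by (simp add: N_def newton_coeff_self newton_coeff_eq_0 c_def)
    qed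
  qed
  have s: "real k \<le> s k" if "k < j" for k
    using unit_spaced_lower_bound[OF us] that by (simp add: \<open>n = j\<close>)
  have bj: "b = \<alpha> j"
    using coeffs[of j] by (simp add: N_def \<open>n = j\<close> newton_coeff_self c_def)
  have ci: "\<alpha> i * c i = \<alpha> j * newton_coeff s j i"
    using coeffs[of i] ij by (simp add: N_def \<open>n = j\<close> bj)
  have "c i \<noteq> 0" using c_sign[of i] ij by auto
  have "j = Suc i"
  proof (rule ccontr)
    assume "j \<noteq> Suc i"
    hence "\<alpha> (j - 1) = 0" using ij by (intro zero) auto
    hence "newton_coeff s j (j - 1) = 0"
      using coeffs[of "j - 1"] b by (simp add: N_def \<open>n = j\<close>)
    hence "newton_coeff s j i = 0" using newton_coeff_subleading_eq_0[of j s i] s ij by blast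
    with ci nz \<open>c i \<noteq> 0\<close> show False by simp
  qed
  moreover have "0 \<le> \<alpha> i * \<alpha> j"
  proof -
    have "newton_coeff s j i \<le> 0"
      using newton_coeff_consecutive_nonpos[of j s i] s
      by (simp add: \<open>j = Suc i\<close> newton_coeff_self del: newton_coeff.simps)
    moreover have "c i < 0" using c_sign[of i] by (simp add: \<open>j = Suc i\<close> flip: mult_2)
    moreover have "(\<alpha> i * \<alpha> j) * c i = \<alpha> j ^ 2 * newton_coeff s j i"
      using ci by (simp add: power2_eq_square mult_ac)
    ultimately have "(\<alpha> i * \<alpha> j) * c i \<le> 0" and "c i < 0"
      by (simp_all add: mult_nonneg_nonpos)
    thus ?thesis by (simp add: mult_le_0_iff)
  qed
  ultimately show ?thesis ..
qed

theorem proposition7: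
  fixes \<alpha> :: "nat \<Rightarrow> real"
  assumes "trivial_sequence \<alpha>"
  shows "discrete_multiplier_sequence \<alpha> \<longleftrightarrow>
    (\<exists>m::nat. \<alpha> m * \<alpha> (m + 1) \<ge> 0 \<and> (\<forall>i. i \<notin> {m, m + 1} \<longrightarrow> \<alpha> i = 0))"
proof
  assume "\<exists>m::nat. \<alpha> m * \<alpha> (m + 1) \<ge> 0 \<and> (\<forall>i. i \<notin> {m, m + 1} \<longrightarrow> \<alpha> i = 0)"
  thus "discrete_multiplier_sequence \<alpha>"
    using discrete_multiplier_sequence_adjacent by auto
next
  assume dms: "discrete_multiplier_sequence \<alpha>"
  let ?S = "{i. \<alpha> i \<noteq> 0}"
  show "\<exists>m::nat. \<alpha> m * \<alpha> (m + 1) \<ge> 0 \<and> (\<forall>i. i \<notin> {m, m + 1} \<longrightarrow> \<alpha> i = 0)"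
  proof (cases "\<exists>i j. i < j \<and> \<alpha> i \<noteq> 0 \<and> \<alpha> j \<noteq> 0")
    case True
    then obtain i j where ij: "i < j" "\<alpha> i \<noteq> 0" "\<alpha> j \<noteq> 0" by blast
    have "{i, j} = ?S"
      by (rule card_seteq) (use assms ij in \<open>auto simp: trivial_sequence_def\<close>)
    hence "\<alpha> k = 0" if "k \<notin> {i, j}" for k using that by blast
    with discrete_multiplier_sequence_two_terms[OF dms ij]
    show ?thesis by (intro exI[of _ i]) auto
  next
    case False
    hence only: "i = j" if "\<alpha> i \<noteq> 0" "\<alpha> j \<noteq> 0" for i j
      using that by (metis nat_neq_iff)
    show ?thesis
    proof (cases "\<exists>m. \<alpha> m \<noteq> 0")
      case True
      then obtain m where m: "\<alpha> m \<noteq> 0" ..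
      \<comment> \<open>A single nonzero entry fits the pattern with \<open>\<alpha>\<^sub>m\<^sub>+\<^sub>1 = 0\<close>.\<close>
      have "\<alpha> (m + 1) = 0" using only[OF m] by fastforce
      with only[OF m] show ?thesis by (intro exI[of _ m]) auto
    qed simp
  qed
qed

end
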